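(* Let $n\ge 3$. Depending on $K$, the dimension of $P_{n,K}$ is: (i) $\dim(P_{n,2})=|E|+n-4$; (ii) $\dim(P_{n,K})=|E|+n-3$ for $K\in\{3,4,\dots,n-2\}$ (i.e. $P_{n,K}$ is full-dimensional); (iii) $\dim(P_{n,n-1})=|E|-1$.
   Context: $V=\{1,\dots,n\}$ and $E$ is the set of all unordered pairs $ij$ of distinct elements of $V$ (edges of the complete graph), so $|E|=n(n-1)/2$; $x_{i,j}=x_{j,i}$. A $K$-partition $\pi$ is a collection of $K$ non-empty pairwise disjoint subsets (clusters) of $V$ whose union is $V$. The representative of a cluster is its smallest element. The characteristic vector $x^\pi\in\{0,1\}^{|E|+|V|-3}$ of $\pi$ has components $x_4,\dots,x_n$ and $x_{i,j}$ for $ij\in E$, where $x^\pi_{i,j}=1$ if $i,j$ are in the same cluster and $0$ otherwise, and $x^\pi_u=1$ if $u$ is the representative of its cluster and $0$ otherwise. (Representative variables of vertices $1,2,3$ are not coordinates.) $P_{n,K}\subset\mathbb R^{|E|+|V|-3}$ is the convex hull of the characteristic vectors $x^\pi$ of all $K$-partitions $\pi$ of $V$ (equivalently, of all $0/1$ solutions of the integer formulation of the $K$-partitioning problem). The dimension of a polytope is the dimension of its affine hull. *)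

theory Defs
  imports "HOL-Analysis.Analysis" "HOL-Library.Disjoint_Sets"
begin

definition K_partition :: "nat \<Rightarrow> nat \<Rightarrow> nat set set \<Rightarrow> bool" where
  "K_partition n K \<pi> \<longleftrightarrow> partition_on {1..n} \<pi> \<and> card \<pi> = K"

definition edges :: "nat \<Rightarrow> nat set set" where
  "edges n = {e. e \<subseteq> {1..n} \<and> card e = 2}"

lemma card_edges: "card (edges n) = n * (n - 1) div 2"
  unfolding edges_def using n_subsets[of "{1..n}" 2] by (simp add: choose_two)

definition representative :: "nat set \<Rightarrow> nat" where
  "representative C = Min C"

text \<open>Coordinate labels: \<open>Edge {i, j}\<close> stands for \<open>x\<^sub>i\<^sub>,\<^sub>j = x\<^sub>j\<^sub>,\<^sub>i\<close>, and \<open>Rep u\<close> for \<open>x\<^sub>u\<close>.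
  The vertices 1, 2, 3 have no representative coordinate.\<close>

datatype coord = Edge "nat set" | Rep nat

definition coords :: "nat \<Rightarrow> coord set" where
  "coords n = Edge ` edges n \<union> Rep ` {4..n}"

fun char_entry :: "nat set set \<Rightarrow> coord \<Rightarrow> real" where
  "char_entry \<pi> (Edge e) = (if \<exists>C\<in>\<pi>. e \<subseteq> C then 1 else 0)"
| "char_entry \<pi> (Rep u) = (if \<exists>C\<in>\<pi>. u \<in> C \<and> u = representative C then 1 else 0)"

text \<open>The ambient space is \<open>real ^ 'i\<close>, where the finite index type \<open>'i\<close> is identified with the
  set of coordinates through a labelling \<open>c\<close>, intended to satisfy
  \<open>bij_betw c UNIV (coords n)\<close>. Then \<open>CARD('i)\<close> is the number of coordinates
  \<open>card (edges n) + n - 3\<close>.\<close>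

definition char_vector :: "('i::finite \<Rightarrow> coord) \<Rightarrow> nat set set \<Rightarrow> real ^ 'i" where
  "char_vector c \<pi> = (\<chi> i. char_entry \<pi> (c i))"

definition partition_polytope :: "('i::finite \<Rightarrow> coord) \<Rightarrow> nat \<Rightarrow> nat \<Rightarrow> (real ^ 'i) set" where
  "partition_polytope c n K = convex hull {char_vector c \<pi> |\<pi>. K_partition n K \<pi>}"

lemma card_coords: "card (coords n) = card (edges n) + (n - 3)"
proof -
  have "finite (edges n)"
    by (rule finite_subset[of _ "Pow {1..n}"]) (auto simp: edges_def)
  then show ?thesis
    unfolding coords_def by (subst card_Un_disjoint) (auto simp: card_image inj_on_def)
qed

end

theory Submission
  imports Defs
begin

text \<open>
  A linear functional on the coordinates, evaluated at a characteristic vector, is a sum of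
  weights of the clusters: edge coefficients inside the cluster plus the coefficient of its
  minimum. For \<open>3 \<le> K \<le> n - 2\<close> suppose the functional is constant on all
  \<open>K\<close>-partitions. Redistributing \<open>{1, i, j}\<close> or \<open>{1, 2, j, l}\<close> over two clusters, with the
  other clusters fixed, forces every coefficient to vanish, so the vectors lie in no hyperplane.
  For \<open>K = 2\<close> the equation \<open>x\<^sub>1\<^sub>,\<^sub>2 + x\<^sub>1\<^sub>,\<^sub>3 + x\<^sub>2\<^sub>,\<^sub>3 - 2 (x\<^sub>4 + \<dots> + x\<^sub>n) = 1\<close> holds, hence the origin
  is off the affine hull; a functional vanishing on all 2-partitions is zero, hence adjoining the
  origin gives full dimension. For \<open>K = n - 1\<close> the partitions consist of one pair and singletons,
  and their edge coordinates are unit vectors.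
\<close>

section \<open>Linear functionals as sums of cluster weights\<close>

definition pair_sum :: "(coord \<Rightarrow> real) \<Rightarrow> nat set \<Rightarrow> real" where
  "pair_sum \<phi> A = (\<Sum>e | e \<subseteq> A \<and> card e = 2. \<phi> (Edge e))"

text \<open>The value 0 below 4 stands in for the missing coordinates of 1, 2, 3, so that
  \<open>cluster_weight\<close> needs no case distinction on the minimum.\<close>

definition rep_coeff :: "(coord \<Rightarrow> real) \<Rightarrow> nat \<Rightarrow> real" where
  "rep_coeff \<phi> u = (if u \<ge> 4 then \<phi> (Rep u) else 0)"

definition cluster_weight :: "(coord \<Rightarrow> real) \<Rightarrow> nat set \<Rightarrow> real" where
  "cluster_weight \<phi> C = pair_sum \<phi> C + rep_coeff \<phi> (Min C)"

lemma pair_sum_empty [simp]: "pair_sum \<phi> {} = 0"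
proof -
  have "{e. e \<subseteq> {} \<and> card e = 2} = ({} :: nat set set)" by auto
  then show ?thesis by (simp only: pair_sum_def sum.empty)
qed

lemma pair_sum_insert:
  assumes "finite A" "x \<notin> A"
  shows "pair_sum \<phi> (insert x A) = pair_sum \<phi> A + (\<Sum>y\<in>A. \<phi> (Edge {x, y}))"
proof -
  have eq: "{e. e \<subseteq> insert x A \<and> card e = 2}
      = {e. e \<subseteq> A \<and> card e = 2} \<union> (\<lambda>y. {x, y}) ` A" (is "?L = ?R")
  proof
    show "?R \<subseteq> ?L" using assms by (auto simp: card_insert_if)
    show "?L \<subseteq> ?R"
    proof
      fix e assume e: "e \<in> ?L"
      show "e \<in> ?R"
      proof (cases "x \<in> e")
        case True
        from e obtain p q where "e = {p, q}" "p \<noteq> q" by (auto simp: card_2_iff)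
        with True e show ?thesis by (auto simp: insert_commute)
      next
        case False
        with e show ?thesis by auto
      qed
    qed
  qed
  have "inj_on (\<lambda>y. {x, y}) A" using assms by (auto simp: inj_on_def doubleton_eq_iff)
  moreover have "{e. e \<subseteq> A \<and> card e = 2} \<inter> (\<lambda>y. {x, y}) ` A = {}" using assms by auto
  ultimately show ?thesis
    unfolding pair_sum_def eq using assms
    by (subst sum.union_disjoint) (auto simp: sum.reindex)
qed

text \<open>Clusters are disjoint, so an edge with entry 1 lies in exactly one of them and
  \<open>Min\<close> is injective on them; both parts of the sum can therefore be regrouped by
  cluster.\<close>

lemma weighted_char_entries:
  assumes "partition_on {1..n} \<pi>"
  shows "(\<Sum>k\<in>coords n. \<phi> k * char_entry \<pi> k) = (\<Sum>C\<in>\<pi>. cluster_weight \<phi> C)"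
proof -
  have sub: "C \<subseteq> {1..n}" and ne: "C \<noteq> {}" if "C \<in> \<pi>" for C
    using assms that by (auto simp: partition_on_def)
  have finC: "finite C" if "C \<in> \<pi>" for C using sub[OF that] finite_subset by blast
  have fin: "finite \<pi>" using assms by (rule finite_elements[rotated]) simp
  have disj: "C = D" if "C \<in> \<pi>" "D \<in> \<pi>" "x \<in> C" "x \<in> D" for C D x
    using assms that by (auto simp: partition_on_def disjoint_def)
  have finE: "finite (edges n)"
    by (rule finite_subset[of _ "Pow {1..n}"]) (auto simp: edges_def)
  let ?P = "\<lambda>C. {e. e \<subseteq> C \<and> card e = 2}"
  have "(\<Sum>e\<in>edges n. \<phi> (Edge e) * char_entry \<pi> (Edge e)) = (\<Sum>e\<in>(\<Union>C\<in>\<pi>. ?P C). \<phi> (Edge e))"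
    using finE sub by (intro sum.mono_neutral_cong_right) (auto simp: edges_def)
  also have "\<dots> = (\<Sum>C\<in>\<pi>. pair_sum \<phi> C)"
    unfolding pair_sum_def
  proof (rule sum.UNION_disjoint)
    show "\<forall>C\<in>\<pi>. finite (?P C)" using finC by auto
    show "\<forall>C\<in>\<pi>. \<forall>D\<in>\<pi>. C \<noteq> D \<longrightarrow> ?P C \<inter> ?P D = {}"
    proof (intro ballI impI, rule ccontr)
      fix C D assume *: "C \<in> \<pi>" "D \<in> \<pi>" "C \<noteq> D" "?P C \<inter> ?P D \<noteq> {}"
      then obtain e where e: "e \<subseteq> C" "e \<subseteq> D" "card e = 2" by auto
      then obtain x where "x \<in> e" by fastforce
      with e * disj show False by blast
    qed
  qed (rule fin)
  finally have 1: "(\<Sum>e\<in>edges n. \<phi> (Edge e) * char_entry \<pi> (Edge e)) = (\<Sum>C\<in>\<pi>. pair_sum \<phi> C)" .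
  have Min_in': "Min C \<in> C" if "C \<in> \<pi>" for C using finC ne that by (intro Min_in) auto
  have "(\<Sum>u\<in>{4..n}. \<phi> (Rep u) * char_entry \<pi> (Rep u)) = (\<Sum>u\<in>Min ` \<pi>. rep_coeff \<phi> u)"
  proof -
    have iff: "(\<exists>C\<in>\<pi>. u \<in> C \<and> u = representative C) \<longleftrightarrow> u \<in> Min ` \<pi>" for u
      using Min_in' by (auto simp: representative_def)
    have "(\<Sum>u\<in>{4..n}. \<phi> (Rep u) * char_entry \<pi> (Rep u)) = (\<Sum>u\<in>{4..n} \<inter> Min ` \<pi>. rep_coeff \<phi> u)"
      unfolding char_entry.simps iff
      by (rule sum.mono_neutral_cong_right) (auto simp: rep_coeff_def)
    \<comment> \<open>The minima added here are among 1, 2, 3, where \<open>rep_coeff\<close> is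
      0.\<close>
    also have "\<dots> = (\<Sum>u\<in>Min ` \<pi>. rep_coeff \<phi> u)"
    proof (rule sum.mono_neutral_left)
      show "\<forall>u\<in>Min ` \<pi> - {4..n} \<inter> Min ` \<pi>. rep_coeff \<phi> u = 0"
      proof
        fix u assume u: "u \<in> Min ` \<pi> - {4..n} \<inter> Min ` \<pi>"
        then obtain C where "C \<in> \<pi>" "u = Min C" by blast
        with Min_in'[of C] sub[of C] have "u \<in> {1..n}" by blast
        with u show "rep_coeff \<phi> u = 0" by (auto simp: rep_coeff_def)
      qed
    qed (use fin in auto)
    finally show ?thesis .
  qed
  also have "\<dots> = (\<Sum>C\<in>\<pi>. rep_coeff \<phi> (Min C))"
  proof (subst sum.reindex)
    show "inj_on Min \<pi>" by (rule inj_onI) (metis disj Min_in')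
  qed simp
  finally have 2: "(\<Sum>u\<in>{4..n}. \<phi> (Rep u) * char_entry \<pi> (Rep u))
      = (\<Sum>C\<in>\<pi>. rep_coeff \<phi> (Min C))" .
  have "(\<Sum>k\<in>coords n. \<phi> k * char_entry \<pi> k)
      = (\<Sum>e\<in>edges n. \<phi> (Edge e) * char_entry \<pi> (Edge e))
        + (\<Sum>u\<in>{4..n}. \<phi> (Rep u) * char_entry \<pi> (Rep u))"
    unfolding coords_def using finE
    by (subst sum.union_disjoint) (auto simp: sum.reindex inj_on_def simp del: char_entry.simps)
  then show ?thesis unfolding 1 2 cluster_weight_def by (simp add: sum.distrib)
qed

lemma inner_char_vector:
  assumes "bij_betw c UNIV (coords n)" "partition_on {1..n} \<pi>"
  shows "(\<chi> i. \<phi> (c i)) \<bullet> char_vector c \<pi> = (\<Sum>C\<in>\<pi>. cluster_weight \<phi> C)"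
proof -
  have "(\<chi> i. \<phi> (c i)) \<bullet> char_vector c \<pi> = (\<Sum>i\<in>UNIV. \<phi> (c i) * char_entry \<pi> (c i))"
    by (simp add: inner_vec_def char_vector_def)
  also have "\<dots> = (\<Sum>k\<in>coords n. \<phi> k * char_entry \<pi> k)"
    by (rule sum.reindex_bij_betw[OF assms(1)])
  finally show ?thesis using weighted_char_entries[OF assms(2)] by simp
qed

text \<open>A set of smaller affine dimension lies in a hyperplane with nonzero normal; the inverse
  of the labelling \<open>c\<close> turns this normal into a functional on coordinate
  labels.\<close>

lemma aff_dim_full_if_no_hyperplane:
  fixes c :: "'i::finite \<Rightarrow> coord" and S :: "(real ^ 'i) set"
  assumes c: "bij_betw c UNIV (coords n)"
    and "\<And>\<phi> b k. (\<And>x. x \<in> S \<Longrightarrow> (\<chi> i. \<phi> (c i)) \<bullet> x = b) \<Longrightarrow> k \<in> coords n \<Longrightarrow> \<phi> k = 0"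
  shows "aff_dim S = int CARD('i)"
proof (rule ccontr)
  assume "aff_dim S \<noteq> int CARD('i)"
  with aff_dim_le_DIM[of S] have "aff_dim S < int DIM(real ^ 'i)" by simp
  then obtain a b where a: "a \<noteq> 0" and S: "S \<subseteq> {x. a \<bullet> x = b}"
    using aff_lowdim_subset_hyperplane by blast
  define \<phi> where "\<phi> k = a $ inv c k" for k
  have "inj c" using c by (simp add: bij_betw_def)
  then have a': "a = (\<chi> i. \<phi> (c i))" by (simp add: \<phi>_def vec_eq_iff)
  with S have "(\<chi> i. \<phi> (c i)) \<bullet> x = b" if "x \<in> S" for x using that by auto
  then have "\<phi> k = 0" if "k \<in> coords n" for k using assms(2) that by blast
  moreover have "c i \<in> coords n" for i using bij_betwE[OF c] by simp
  ultimately have "a = 0" by (simp add: a' vec_eq_iff)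
  with a show False by simp
qed

section \<open>The range from 3 to n - 2 clusters\<close>

text \<open>Take \<open>k - 1\<close> singletons and put all remaining elements into one
  block.\<close>

lemma partition_on_exists:
  assumes "finite A" "1 \<le> k" "k \<le> card A"
  shows "\<exists>\<pi>. partition_on A \<pi> \<and> card \<pi> = k"
proof -
  from assms obtain B where B: "B \<subseteq> A" "card B = k - 1"
    using obtain_subset_with_card_n[of "k - 1" A] by (metis diff_le_self le_trans)
  have fB: "finite B" using B assms finite_subset by blast
  have "card B < card A" using B assms by simp
  then have ne: "A - B \<noteq> {}" using B by auto
  let ?\<pi> = "insert (A - B) ((\<lambda>x. {x}) ` B)"
  have "A - B \<notin> (\<lambda>x. {x}) ` B" by auto
  then have "card ?\<pi> = k" using fB B assms by (simp add: card_image)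
  moreover have "partition_on A ?\<pi>"
    using B ne by (auto simp: partition_on_def disjoint_def)
  ultimately show ?thesis by blast
qed

text \<open>The bound on \<open>card U\<close> leaves at least \<open>K - 2\<close> elements outside
  \<open>U\<close>. A fixed partition \<rho> of them into \<open>K - 2\<close> clusters is completed
  to a \<open>K\<close>-partition by any split of \<open>U\<close> in two, so \<open>d\<close> is
  \<open>b\<close> minus the weight of \<rho>.\<close>

lemma cluster_weight_split:
  assumes K: "3 \<le> K" "K \<le> n"
    and const: "\<And>\<pi>. K_partition n K \<pi> \<Longrightarrow> (\<Sum>C\<in>\<pi>. cluster_weight \<phi> C) = b"
    and U: "U \<subseteq> {1..n}" "card U \<le> n + 2 - K"
  obtains d where
    "\<And>A B. A \<union> B = U \<Longrightarrow> A \<inter> B = {} \<Longrightarrow> A \<noteq> {} \<Longrightarrow> B \<noteq> {} \<Longrightarrow>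
      cluster_weight \<phi> A + cluster_weight \<phi> B = d"
proof -
  have fU: "finite U" using U finite_subset by blast
  have "card ({1..n} - U) = n - card U" using U fU by (simp add: card_Diff_subset)
  then obtain \<rho> where \<rho>: "partition_on ({1..n} - U) \<rho>" "card \<rho> = K - 2"
    using partition_on_exists[of "{1..n} - U" "K - 2"] K U by fastforce
  have f\<rho>: "finite \<rho>" using \<rho>(1) by (rule finite_elements[rotated]) simp
  have "cluster_weight \<phi> A + cluster_weight \<phi> B = b - (\<Sum>C\<in>\<rho>. cluster_weight \<phi> C)"
    if AB: "A \<union> B = U" "A \<inter> B = {}" "A \<noteq> {}" "B \<noteq> {}" for A B
  proof -
    have notin: "A \<notin> \<rho>" "B \<notin> \<rho>" "A \<noteq> B" using AB \<rho>(1) by (auto simp: partition_on_def)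
    have part: "partition_on {1..n} (insert A (insert B \<rho>))"
      unfolding partition_on_def
    proof (intro conjI)
      show "\<Union> (insert A (insert B \<rho>)) = {1..n}"
        using \<rho>(1) AB U by (auto simp: partition_on_def)
      have *: "\<Union> \<rho> = {1..n} - U" "disjoint \<rho>" using \<rho>(1) by (auto simp: partition_on_def)
      then have **: "A \<inter> C = {}" "B \<inter> C = {}" if "C \<in> \<rho>" for C using AB that by blast+
      show "disjoint (insert A (insert B \<rho>))"
        using * ** AB by (auto simp: disjoint_def)
      show "{} \<notin> insert A (insert B \<rho>)" using \<rho>(1) AB by (auto simp: partition_on_def)
    qed
    have "K_partition n K (insert A (insert B \<rho>))"
      using part notin f\<rho> \<rho>(2) K by (simp add: K_partition_def)
    from const[OF this] show ?thesis using notin f\<rho> by simp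
  qed
  then show thesis using that by blast
qed

lemma functional_zero_middle:
  assumes K: "3 \<le> K" "K \<le> n - 2"
    and const: "\<And>\<pi>. K_partition n K \<pi> \<Longrightarrow> (\<Sum>C\<in>\<pi>. cluster_weight \<phi> C) = b"
    and k: "k \<in> coords n"
  shows "\<phi> k = 0"
proof -
  have Kn: "K \<le> n" using K by simp
  define r where "r = rep_coeff \<phi>"
  define \<gamma> where "\<gamma> j = \<phi> (Edge {1, j})" for j
  have r3: "r 1 = 0" "r 2 = 0" "r 3 = 0" by (auto simp: r_def rep_coeff_def)
  \<comment> \<open>Compare the three splits of \<open>{1, i, j}\<close> into a singleton and a
    pair; their weights are \<open>\<phi> (Edge {i, j}) + r i\<close>,
    \<open>r i + \<gamma> j\<close> and \<open>r j + \<gamma> i\<close>.\<close>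
  have triple: "\<phi> (Edge {i, j}) = \<gamma> j \<and> r i + \<gamma> j = r j + \<gamma> i"
    if ij: "1 < i" "i < j" "j \<le> n" for i j
  proof -
    have "card {1, i, j} \<le> n + 2 - K" using ij K by (simp add: card_insert_if)
    then obtain d where d: "\<And>A B. A \<union> B = {1, i, j} \<Longrightarrow> A \<inter> B = {} \<Longrightarrow> A \<noteq> {} \<Longrightarrow> B \<noteq> {} \<Longrightarrow>
        cluster_weight \<phi> A + cluster_weight \<phi> B = d"
      using cluster_weight_split[where n = n and K = K and b = b and U = "{1, i, j}" and \<phi> = \<phi>]
        const K Kn ij by auto
    from d[of "{1}" "{i, j}"] d[of "{i}" "{1, j}"] d[of "{j}" "{1, i}"] ij
    show ?thesis
      by (auto simp: cluster_weight_def pair_sum_insert \<gamma>_def r_def insert_commute)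
  qed
  \<comment> \<open>Four elements fit because \<open>K \<le> n - 2\<close>. The splits
    \<open>{j}\<close>, \<open>{1, 2, l}\<close> and \<open>{1, 2}\<close>, \<open>{j, l}\<close>
    have the same representatives, and by \<open>triple\<close> their edge sums differ by
    \<open>\<gamma> l\<close> alone. The split \<open>{l}\<close>, \<open>{1, 2, j}\<close> then
    yields \<open>\<gamma> j = 0\<close>.\<close>
  have quad: "\<gamma> l = 0 \<and> \<gamma> j = 0"
    if ij: "2 < j" "j < l" "l \<le> n" for j l
  proof -
    have "card {1, 2, j, l} \<le> n + 2 - K" using ij K by (simp add: card_insert_if)
    then obtain d where d: "\<And>A B. A \<union> B = {1, 2, j, l} \<Longrightarrow> A \<inter> B = {} \<Longrightarrow> A \<noteq> {} \<Longrightarrow> B \<noteq> {} \<Longrightarrow>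
        cluster_weight \<phi> A + cluster_weight \<phi> B = d"
      using cluster_weight_split[where n = n and K = K and b = b and U = "{1, 2, j, l}" and \<phi> = \<phi>]
        const K Kn ij by auto
    have e: "\<phi> (Edge {2, j}) = \<gamma> j" "\<phi> (Edge {2, l}) = \<gamma> l" "\<phi> (Edge {j, l}) = \<gamma> l"
      "\<phi> (Edge {1, j}) = \<gamma> j" "\<phi> (Edge {1, l}) = \<gamma> l" "r j + \<gamma> l = r l + \<gamma> j"
      using triple[of 2 j] triple[of 2 l] triple[of j l] ij by (auto simp: \<gamma>_def)
    have "cluster_weight \<phi> {j} + cluster_weight \<phi> {1, 2, l} = d"
      "cluster_weight \<phi> {1, 2} + cluster_weight \<phi> {j, l} = d"
      "cluster_weight \<phi> {l} + cluster_weight \<phi> {1, 2, j} = d"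
      using ij by (intro d; auto)+
    with ij e show ?thesis
      by (auto simp: cluster_weight_def pair_sum_insert r_def)
  qed
  \<comment> \<open>\<open>quad\<close> does not reach \<open>\<gamma> 2\<close>; it follows from
    \<open>\<gamma> 3 = 0\<close> by the exchange relation for 2 and 3, whose representative
    coefficients are both 0.\<close>
  have "\<gamma> 3 = 0" using quad[of 3 4] K by simp
  moreover have "r 2 + \<gamma> 3 = r 3 + \<gamma> 2" using triple[of 2 3] K by simp
  ultimately have g2: "\<gamma> 2 = 0" using r3 by simp
  have g: "\<gamma> j = 0" if "1 < j" "j \<le> n" for j
  proof -
    have "j = 2 \<or> j = 3 \<or> j > 3" using that by linarith
    then show ?thesis using g2 \<open>\<gamma> 3 = 0\<close> quad[of 3 j] that by auto
  qed
  have rz: "r j = 0" if "4 \<le> j" "j \<le> n" for j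
    using triple[of 2 j] g[of j] g2 r3 that by simp
  have edge: "\<phi> (Edge {i, j}) = 0" if "1 \<le> i" "i < j" "j \<le> n" for i j
    using triple[of i j] g[of j] that by (cases "i = 1") (auto simp: \<gamma>_def)
  from k consider e where "k = Edge e" "e \<in> edges n" | u where "k = Rep u" "4 \<le> u" "u \<le> n"
    by (auto simp: coords_def)
  then show ?thesis
  proof cases
    case 1
    then obtain p q where "e = {p, q}" "p \<noteq> q" "p \<in> {1..n}" "q \<in> {1..n}"
      by (auto simp: edges_def card_2_iff)
    then show ?thesis using edge[of p q] edge[of q p] 1
      by (cases "p < q") (auto simp: insert_commute)
  next
    case 2
    then show ?thesis using rz[of u] by (simp add: r_def rep_coeff_def)
  qed
qed

section \<open>Two clusters\<close>

text \<open>The complement of \<open>A\<close> contains 1, so its representative has coefficient 0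
  and only \<open>Min A\<close> contributes.\<close>

lemma two_partition_weight:
  assumes "A \<subseteq> {2..n}" "A \<noteq> {}" "n \<ge> 1"
  shows "K_partition n 2 {A, {1..n} - A}"
    and "(\<Sum>C\<in>{A, {1..n} - A}. cluster_weight \<phi> C)
      = pair_sum \<phi> A + pair_sum \<phi> ({1..n} - A) + rep_coeff \<phi> (Min A)"
proof -
  have ne: "A \<noteq> {1..n} - A" "1 \<in> {1..n} - A" using assms by auto
  then show "K_partition n 2 {A, {1..n} - A}"
    using assms by (auto simp: K_partition_def partition_on_def disjoint_def)
  have "Min ({1..n} - A) = 1" using ne by (intro Min_eqI) auto
  then show "(\<Sum>C\<in>{A, {1..n} - A}. cluster_weight \<phi> C)
      = pair_sum \<phi> A + pair_sum \<phi> ({1..n} - A) + rep_coeff \<phi> (Min A)"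
    using ne by (simp add: cluster_weight_def rep_coeff_def)
qed

text \<open>Choosing the cluster that avoids 1 as \<open>A\<close> brings every 2-partition into the
  form of \<open>two_partition_weight\<close>.\<close>

lemma two_partition_cases:
  assumes "K_partition n 2 \<pi>" "n \<ge> 1"
  obtains A where "A \<subseteq> {2..n}" "A \<noteq> {}" "\<pi> = {A, {1..n} - A}"
proof -
  from assms obtain C D where CD: "\<pi> = {C, D}" "C \<noteq> D" by (auto simp: K_partition_def card_2_iff)
  have *: "C \<union> D = {1..n}" "C \<inter> D = {}" "C \<noteq> {}" "D \<noteq> {}"
    using assms(1) CD by (auto simp: K_partition_def partition_on_def disjoint_def)
  have sub: "X \<subseteq> {2..n}" if "X \<subseteq> {1..n}" "1 \<notin> X" for X
  proof
    fix x assume "x \<in> X"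
    with that have "x \<in> {1..n}" "x \<noteq> 1" by auto
    then show "x \<in> {2..n}" by auto
  qed
  show thesis
  proof (cases "1 \<in> C")
    case True
    have "C = {1..n} - D" using * by auto
    then show thesis using True * CD sub[of D] that[of D] by (metis Int_iff Un_upper2 empty_iff insert_commute)
  next
    case False
    have "D = {1..n} - C" using * by auto
    then show thesis using False * CD sub[of C] that[of C] by (metis Un_upper1)
  qed
qed

text \<open>All coefficients are expressed through the total edge weight \<open>T\<close>: the three
  edges among 1, 2, 3 have coefficient \<open>T / 2\<close>, all other edges 0, and every
  representative coefficient is \<open>- T\<close>. Summing the edges gives
  \<open>T = 3 * (T / 2)\<close>, so \<open>T = 0\<close>.\<close>

lemma functional_zero_two:
  assumes n: "n \<ge> 3"
    and const: "\<And>\<pi>. K_partition n 2 \<pi> \<Longrightarrow> (\<Sum>C\<in>\<pi>. cluster_weight \<phi> C) = 0"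
    and k: "k \<in> coords n"
  shows "\<phi> k = 0"
proof -
  define r where "r = rep_coeff \<phi>"
  define \<alpha> where "\<alpha> i j = \<phi> (Edge {i, j})" for i j
  define \<delta> where "\<delta> i = (\<Sum>j\<in>{1..n} - {i}. \<alpha> i j)" for i
  define q where "q A = pair_sum \<phi> A + pair_sum \<phi> ({1..n} - A)" for A
  define T where "T = pair_sum \<phi> {1..n}"
  txt \<open>Up to the constant \<open>T\<close>, \<open>q A\<close> is minus the weight of the cut between \<open>A\<close> and its complement,
    so it is known from the degrees and the edges inside \<open>A\<close>; by \<open>const\<close> it depends on \<open>Min A\<close> only.\<close>
  have \<alpha>_sym: "\<alpha> i j = \<alpha> j i" for i j by (simp add: \<alpha>_def insert_commute)
  have r3: "r 2 = 0" "r 3 = 0" by (auto simp: r_def rep_coeff_def)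
  have q: "q A = - r (Min A)" if "A \<subseteq> {2..n}" "A \<noteq> {}" for A
    using const[OF two_partition_weight(1)] two_partition_weight(2)[of A n \<phi>] that n
    by (simp add: q_def r_def)
  \<comment> \<open>Moving \<open>i\<close> into \<open>A\<close> gains the edges from
    \<open>i\<close> to \<open>A\<close> and loses those to the rest; the lost sum is
    \<open>\<delta> i\<close> minus the gained one.\<close>
  have step: "q (insert i A) = q A + 2 * (\<Sum>j\<in>A. \<alpha> i j) - \<delta> i"
    if "A \<subseteq> {1..n}" "i \<in> {1..n}" "i \<notin> A" for i A
  proof -
    let ?B = "{1..n} - insert i A"
    have fA: "finite A" using that finite_subset by blast
    have compl: "{1..n} - A = insert i ?B" using that by auto
    have "pair_sum \<phi> ({1..n} - A) = pair_sum \<phi> ?B + (\<Sum>j\<in>?B. \<alpha> i j)"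
      unfolding \<alpha>_def by (subst compl, rule pair_sum_insert) auto
    moreover have "\<delta> i = (\<Sum>j\<in>A. \<alpha> i j) + (\<Sum>j\<in>?B. \<alpha> i j)"
    proof -
      have rest: "{1..n} - {i} = A \<union> ?B" using that by auto
      show ?thesis unfolding \<delta>_def rest using fA by (intro sum.union_disjoint) auto
    qed
    ultimately show ?thesis
      using that fA by (simp add: q_def pair_sum_insert \<alpha>_def)
  qed
  \<comment> \<open>The empty set is no cluster, but it is the starting point from which
    \<open>step\<close> reaches the singletons.\<close>
  have q0: "q {} = T" by (simp add: q_def T_def)
  have deg: "\<delta> i = T + r i" if "2 \<le> i" "i \<le> n" for i
    using step[of "{}" i] q[of "{i}"] q0 that by simp
  \<comment> \<open>\<open>{i}\<close> and \<open>{i, j}\<close> have the same minimum, hence the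
    same \<open>q\<close>; so \<open>step\<close> forces
    \<open>2 * \<alpha> i j = \<delta> j\<close>.\<close>
  have pair_q: "q {i, j} = - r i" and pair: "2 * \<alpha> i j = T + r j"
    if ij: "2 \<le> i" "i < j" "j \<le> n" for i j
  proof -
    show *: "q {i, j} = - r i" using q[of "{i, j}"] ij by simp
    have "q {j, i} = q {i} + 2 * \<alpha> j i - \<delta> j" using step[of "{i}" j] ij by simp
    moreover have "q {i} = - r i" using q[of "{i}"] ij by simp
    ultimately show "2 * \<alpha> i j = T + r j"
      using * deg[of j] ij \<alpha>_sym[of i j] by (simp add: insert_commute)
  qed
  \<comment> \<open>Adding \<open>l\<close> to \<open>{2, 3}\<close> keeps the minimum 2, so
    \<open>2 * (\<alpha> 2 l + \<alpha> 3 l) = T + r l\<close>. By \<open>pair\<close> the term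
    \<open>2 * \<alpha> 3 l\<close> alone already has this value.\<close>
  have zero2: "\<alpha> 2 l = 0" and rT: "r l = - T" if l: "4 \<le> l" "l \<le> n" for l
  proof -
    have "q (insert l {2, 3}) = q {2, 3} + 2 * (\<alpha> l 2 + \<alpha> l 3) - \<delta> l"
      using step[of "{2, 3}" l] l by simp
    moreover have "q (insert l {2, 3}) = - r 2" using q[of "insert l {2, 3}"] l by simp
    moreover have "q {2, 3} = - r 2" using pair_q[of 2 3] l by simp
    ultimately have "2 * (\<alpha> 2 l + \<alpha> 3 l) = T + r l"
      using deg[of l] l \<alpha>_sym[of l] by simp
    then show "\<alpha> 2 l = 0" using pair[of 3 l] l by simp
    then show "r l = - T" using pair[of 2 l] l by simp
  qed
  have zero: "\<alpha> i l = 0" if "2 \<le> i" "i < l" "4 \<le> l" "l \<le> n" for i l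
    using pair[of i l] rT[of l] that by simp
  have a23: "\<alpha> 2 3 = T / 2" using pair[of 2 3] n r3 by simp
  \<comment> \<open>Only 1 and 3 survive in the degree of 2, which equals \<open>T\<close> because
    \<open>r 2 = 0\<close>; the degree of 3 is treated likewise.\<close>
  have "\<delta> 2 = (\<Sum>j\<in>{1, 3}. \<alpha> 2 j)"
    unfolding \<delta>_def
  proof (rule sum.mono_neutral_right)
    show "\<forall>j\<in>{1..n} - {2} - {1, 3}. \<alpha> 2 j = 0" using zero2 by auto
  qed (use n in auto)
  then have a12: "\<alpha> 1 2 = T / 2" using deg[of 2] r3 n a23 \<alpha>_sym[of 1 2] by simp
  have "\<delta> 3 = (\<Sum>j\<in>{1, 2}. \<alpha> 3 j)"
    unfolding \<delta>_def
  proof (rule sum.mono_neutral_right)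
    show "\<forall>j\<in>{1..n} - {3} - {1, 2}. \<alpha> 3 j = 0" using zero[of 3] by auto
  qed (use n in auto)
  then have a13: "\<alpha> 1 3 = T / 2" using deg[of 3] r3 n a23 \<alpha>_sym[of 1 3] \<alpha>_sym[of 3 2] by simp
  \<comment> \<open>The degree of \<open>l\<close> is \<open>T + r l = 0\<close>, and its only
    surviving term is the edge to 1.\<close>
  have zero1: "\<alpha> 1 l = 0" if l: "4 \<le> l" "l \<le> n" for l
  proof -
    have "\<delta> l = (\<Sum>j\<in>{1}. \<alpha> l j)"
      unfolding \<delta>_def
    proof (rule sum.mono_neutral_right)
      show "\<forall>j\<in>{1..n} - {l} - {1}. \<alpha> l j = 0"
      proof
        fix j assume j: "j \<in> {1..n} - {l} - {1}"
        then show "\<alpha> l j = 0"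
          using zero[of j l] zero[of l j] l \<alpha>_sym[of j l] by (cases "j < l") auto
      qed
    qed (use l in auto)
    then show ?thesis using deg[of l] rT[of l] l \<alpha>_sym[of 1 l] by simp
  qed
  have far: "\<alpha> i j = 0" if "1 \<le> i" "i < j" "4 \<le> j" "j \<le> n" for i j
    using zero[of i j] zero1[of j] that by (cases "i = 1") auto
  have edge_cases: "(e = {1, 2} \<or> e = {1, 3} \<or> e = {2, 3}) \<or> \<phi> (Edge e) = 0"
    if "e \<in> edges n" for e
  proof -
    from that obtain a b where "e = {a, b}" "a \<noteq> b" "a \<in> {1..n}" "b \<in> {1..n}"
      by (auto simp: edges_def card_2_iff)
    then obtain i j where ij: "e = {i, j}" "i < j" "1 \<le> i" "j \<le> n"
      by (metis atLeastAtMost_iff insert_commute linorder_neqE_nat)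
    show ?thesis
    proof (cases "j \<ge> 4")
      case True
      then show ?thesis using far[of i j] ij by (simp add: \<alpha>_def)
    next
      case False
      then have "(i = 1 \<and> j = 2) \<or> (i = 1 \<and> j = 3) \<or> (i = 2 \<and> j = 3)" using ij by linarith
      then show ?thesis using ij by auto
    qed
  qed
  have "T = (\<Sum>e\<in>{{1, 2}, {1, 3}, {2, 3}}. \<phi> (Edge e))"
    unfolding T_def pair_sum_def
  proof (rule sum.mono_neutral_right)
    show "\<forall>e\<in>{e. e \<subseteq> {1..n} \<and> card e = 2} - {{1, 2}, {1, 3}, {2, 3}}. \<phi> (Edge e) = 0"
      using edge_cases by (auto simp: edges_def)
  qed (use n in auto)
  also have "\<dots> = 3 * (T / 2)"
    using a12 a13 a23 by (simp add: \<alpha>_def doubleton_eq_iff)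
  finally have T: "T = 0" by simp
  from k consider e where "k = Edge e" "e \<in> edges n" | u where "k = Rep u" "4 \<le> u" "u \<le> n"
    by (auto simp: coords_def)
  then show ?thesis
  proof cases
    case 1
    then show ?thesis using edge_cases[of e] a12 a13 a23 T by (auto simp: \<alpha>_def)
  next
    case 2
    then show ?thesis using rT[of u] T by (simp add: r_def rep_coeff_def)
  qed
qed

text \<open>\<open>x\<^sub>1\<^sub>,\<^sub>2 + x\<^sub>1\<^sub>,\<^sub>3 + x\<^sub>2\<^sub>,\<^sub>3\<close> is 3 or 1 according to whether 1, 2, 3 share a cluster, and exactly in the
  first case the other cluster has its representative among \<open>4, \<dots>, n\<close>.\<close>

fun two_cluster_form :: "coord \<Rightarrow> real" where
  "two_cluster_form (Edge e) = (if e \<in> {{1, 2}, {1, 3}, {2, 3}} then 1 else 0)"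
| "two_cluster_form (Rep u) = - 2"

lemma two_cluster_form_eq:
  assumes "K_partition n 2 \<pi>" "n \<ge> 3"
  shows "(\<Sum>C\<in>\<pi>. cluster_weight two_cluster_form C) = 1"
proof -
  from assms obtain A where A: "A \<subseteq> {2..n}" "A \<noteq> {}" "\<pi> = {A, {1..n} - A}"
    using two_partition_cases by (metis le_trans one_le_numeral)
  have ps: "pair_sum two_cluster_form B =
      of_bool ({1, 2} \<subseteq> B) + of_bool ({1, 3} \<subseteq> B) + of_bool ({2, 3} \<subseteq> B)" if "finite B" for B
  proof -
    let ?P = "{e. e \<subseteq> B \<and> card e = 2}" and ?X = "{{1, 2}, {1, 3}, {2, 3}} :: nat set set"
    have "pair_sum two_cluster_form B = (\<Sum>e\<in>?P \<inter> ?X. 1)"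
      unfolding pair_sum_def two_cluster_form.simps using that
      by (intro sum.inter_restrict[symmetric]) auto
    \<comment> \<open>With the three explicit edges in front, the sum can be evaluated term by
      term.\<close>
    also have "?P \<inter> ?X = ?X \<inter> ?P" by (rule Int_commute)
    also have "(\<Sum>e\<in>?X \<inter> ?P. 1) = (\<Sum>e\<in>?X. if e \<in> ?P then 1 else 0 :: real)"
      by (rule sum.inter_restrict) simp
    also have "\<dots> = (\<Sum>e\<in>?X. of_bool (e \<subseteq> B))"
      by (rule sum.cong) auto
    finally show ?thesis by (simp add: doubleton_eq_iff)
  qed
  have fA: "finite A" using A finite_subset by blast
  have M_in: "Min A \<in> A" using A fA by simp
  have M: "Min A \<ge> 4 \<longleftrightarrow> 2 \<notin> A \<and> 3 \<notin> A"
  proof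
    assume "4 \<le> Min A"
    then show "2 \<notin> A \<and> 3 \<notin> A" using Min_le[OF fA, of 2] Min_le[OF fA, of 3] by auto
  next
    assume "2 \<notin> A \<and> 3 \<notin> A"
    with M_in have "Min A \<noteq> 2" "Min A \<noteq> 3" by metis+
    moreover have "Min A \<ge> 2" using subsetD[OF A(1) M_in] by simp
    ultimately show "Min A \<ge> 4" by linarith
  qed
  have "1 \<notin> A" using A(1) by auto
  then have "pair_sum two_cluster_form A + pair_sum two_cluster_form ({1..n} - A)
      + rep_coeff two_cluster_form (Min A) = 1"
    using assms(2) M by (simp add: ps fA rep_coeff_def)
  moreover have "1 \<le> n" using assms(2) by simp
  ultimately show ?thesis
    unfolding A(3) using two_partition_weight(2)[OF A(1,2)] by simp
qed

section \<open>Partitions into n - 1 clusters\<close>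

definition pair_partition :: "nat \<Rightarrow> nat set \<Rightarrow> nat set set" where
  "pair_partition n e = insert e ((\<lambda>k. {k}) ` ({1..n} - e))"

text \<open>The sizes of \<open>n - 1\<close> nonempty clusters add up to \<open>n\<close>, so the
  excesses \<open>card C - 1\<close> add up to 1: one cluster is a pair and the others are
  singletons.\<close>

lemma K_partition_pred_iff:
  assumes "n \<ge> 2"
  shows "K_partition n (n - 1) \<pi> \<longleftrightarrow> (\<exists>e\<in>edges n. \<pi> = pair_partition n e)"
proof
  assume "\<exists>e\<in>edges n. \<pi> = pair_partition n e"
  then obtain e where e: "e \<subseteq> {1..n}" "card e = 2" and \<pi>: "\<pi> = pair_partition n e"
    by (auto simp: edges_def)
  have "e \<notin> (\<lambda>k. {k}) ` ({1..n} - e)" by auto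
  moreover have "card ({1..n} - e) = n - 2"
    using e by (simp add: card_Diff_subset finite_subset)
  ultimately have "card \<pi> = n - 1"
    using assms unfolding \<pi> pair_partition_def by (simp add: card_image)
  moreover have "partition_on {1..n} \<pi>"
    using e unfolding \<pi> pair_partition_def by (auto simp: partition_on_def disjoint_def)
  ultimately show "K_partition n (n - 1) \<pi>" by (simp add: K_partition_def)
next
  assume "K_partition n (n - 1) \<pi>"
  then have part: "partition_on {1..n} \<pi>" and card: "card \<pi> = n - 1"
    by (auto simp: K_partition_def)
  have fin: "finite \<pi>" using part by (rule finite_elements[rotated]) simp
  have U: "\<Union> \<pi> = {1..n}" using part by (simp add: partition_on_def)
  have finC: "finite C" and neC: "C \<noteq> {}" if "C \<in> \<pi>" for C
    using part that finite_subset[of C "{1..n}"] by (auto simp: partition_on_def)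
  then have c1: "card C \<ge> 1" if "C \<in> \<pi>" for C
    using that by (simp add: Suc_le_eq card_gt_0_iff)
  have "(\<Sum>C\<in>\<pi>. card C) = card (\<Union> \<pi>)"
    using part finC by (intro card_Union_disjoint[symmetric]) (auto simp: partition_on_def disjoint_def pairwise_def disjnt_def)
  then have "(\<Sum>C\<in>\<pi>. card C) = n" using U by simp
  moreover have "(\<Sum>C\<in>\<pi>. card C) = (\<Sum>C\<in>\<pi>. (card C - 1) + 1)"
  proof (rule sum.cong)
    fix C assume "C \<in> \<pi>"
    with c1[of C] show "card C = (card C - 1) + 1" by simp
  qed simp
  ultimately have "(\<Sum>C\<in>\<pi>. card C - 1) = 1"
    using card assms unfolding sum.distrib by simp
  then have "\<exists>e\<in>\<pi>. card e - 1 = 1 \<and> (\<forall>C\<in>\<pi>. e \<noteq> C \<longrightarrow> card C - 1 = 0)"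
    using fin by (simp only: sum_eq_1_iff)
  then obtain e where e: "e \<in> \<pi>" "card e - 1 = 1"
    and others: "\<And>C. C \<in> \<pi> \<Longrightarrow> C \<noteq> e \<Longrightarrow> card C - 1 = 0"
    by metis
  have single: "\<exists>k. C = {k}" if "C \<in> \<pi>" "C \<noteq> e" for C
    using others[OF that] c1[OF that(1)] by (simp flip: card_1_singleton_iff)
  have disj: "C \<inter> D = {}" if "C \<in> \<pi>" "D \<in> \<pi>" "C \<noteq> D" for C D
    using part that by (auto simp: partition_on_def disjoint_def)
  have "\<pi> = pair_partition n e"
  proof (rule set_eqI, rule iffI)
    fix C assume C: "C \<in> \<pi>"
    show "C \<in> pair_partition n e"
    proof (cases "C = e")
      case False
      then obtain k where k: "C = {k}" using single C by blast
      with disj[OF C e(1) False] C U have "k \<in> {1..n} - e" by auto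
      with k show ?thesis by (auto simp: pair_partition_def)
    qed (simp add: pair_partition_def)
  next
    fix C assume "C \<in> pair_partition n e"
    then consider "C = e" | k where "C = {k}" "k \<in> {1..n}" "k \<notin> e"
      by (auto simp: pair_partition_def)
    then show "C \<in> \<pi>"
    proof cases
      case 2
      then obtain D where "D \<in> \<pi>" "k \<in> D" using U by blast
      with single[of D] 2 show ?thesis by auto
    qed (use e in simp)
  qed
  moreover have "e \<in> edges n" using e U by (auto simp: edges_def)
  ultimately show "\<exists>e\<in>edges n. \<pi> = pair_partition n e" by blast
qed

text \<open>No edge fits into a singleton, and an edge inside another edge equals it by
  cardinality.\<close>

lemma char_entry_pair_partition:
  assumes "e \<in> edges n" "f \<in> edges n"
  shows "char_entry (pair_partition n e) (Edge f) = of_bool (e = f)"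
proof -
  have c: "card e = 2" "card f = 2" "finite e"
    using assms finite_subset[of e "{1..n}"] by (auto simp: edges_def)
  have "\<not> f \<subseteq> {k}" for k using c card_mono[of "{k}" f] by auto
  moreover have "f \<subseteq> e \<longleftrightarrow> e = f" using c card_subset_eq[of e f] by auto
  ultimately show ?thesis by (auto simp: pair_partition_def)
qed

text \<open>The coordinate of an edge \<open>f\<close> is 1 on the vector of \<open>f\<close> and 0
  on all others, so the vectors are distinct and linearly independent, hence affinely
  independent.\<close>

lemma aff_dim_pair_partitions:
  fixes c :: "'i::finite \<Rightarrow> coord"
  assumes c: "bij_betw c UNIV (coords n)"
  shows "aff_dim ((\<lambda>e. char_vector c (pair_partition n e)) ` edges n) = int (card (edges n)) - 1"
proof -
  define v where "v e = char_vector c (pair_partition n e)" for e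
  have finE: "finite (edges n)"
    by (rule finite_subset[of _ "Pow {1..n}"]) (auto simp: edges_def)
  have v: "\<exists>i. \<forall>e\<in>edges n. v e $ i = of_bool (e = f)" if f: "f \<in> edges n" for f
  proof -
    have "Edge f \<in> coords n" using f by (simp add: coords_def)
    then obtain i where "c i = Edge f" using c unfolding bij_betw_def by (metis imageE)
    then show ?thesis
      using char_entry_pair_partition f
      by (intro exI[of _ i]) (simp add: v_def char_vector_def del: char_entry.simps)
  qed
  have inj: "inj_on v (edges n)"
  proof (rule inj_onI)
    fix e f assume ef: "e \<in> edges n" "f \<in> edges n" "v e = v f"
    from v[OF ef(2)] obtain i where "\<forall>e\<in>edges n. v e $ i = of_bool (e = f)" by blast
    with ef have "of_bool (e = f) = (1 :: real)" by (metis of_bool_eq(2))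
    then show "e = f" by (cases "e = f") simp_all
  qed
  have "independent (v ` edges n)"
    unfolding dependent_finite[OF finite_imageI[OF finE]]
  proof (rule notI, elim exE conjE bexE)
    fix u x assume x: "x \<in> v ` edges n" "u x \<noteq> 0" and 0: "(\<Sum>x\<in>v ` edges n. u x *\<^sub>R x) = 0"
    then obtain f where f: "f \<in> edges n" "x = v f" by blast
    obtain i where i: "\<forall>e\<in>edges n. v e $ i = of_bool (e = f)" using v f by blast
    \<comment> \<open>Reading the vanishing combination in the coordinate of \<open>f\<close>
      isolates the coefficient \<open>u x\<close>.\<close>
    have "0 = (\<Sum>e\<in>edges n. u (v e) * v e $ i)"
      using arg_cong[OF 0, of "\<lambda>y. y $ i"] by (simp add: sum.reindex[OF inj] sum_component)
    also have "\<dots> = (\<Sum>e\<in>edges n. if e = f then u (v e) else 0)"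
      using i by (intro sum.cong) auto
    also have "\<dots> = u x" using f finE by simp
    finally show False using x by simp
  qed
  then have "\<not> affine_dependent (v ` edges n)" using affine_dependent_imp_dependent by blast
  then have "aff_dim (v ` edges n) = int (card (v ` edges n)) - 1"
    by (simp add: aff_dim_affine_independent)
  then show ?thesis using card_image[OF inj] by (simp add: v_def[abs_def])
qed

theorem theorem3p5:
  fixes n :: nat and c :: "'i::finite \<Rightarrow> coord"
  assumes "n \<ge> 3"
    and "bij_betw c UNIV (coords n)"
  shows "aff_dim (partition_polytope c n 2) = int (card (edges n)) + int n - 4
    \<and> (\<forall>K\<in>{3..n - 2}. aff_dim (partition_polytope c n K) = int (card (edges n)) + int n - 3
           \<and> aff_dim (partition_polytope c n K) = int DIM(real ^ 'i))
    \<and> aff_dim (partition_polytope c n (n - 1)) = int (card (edges n)) - 1"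
proof -
  define S where "S K = {char_vector c \<pi> |\<pi>. K_partition n K \<pi>}" for K
  have dim: "aff_dim (partition_polytope c n K) = aff_dim (S K)" for K
    by (simp add: partition_polytope_def S_def aff_dim_convex_hull)
  have "CARD('i) = card (coords n)" using assms(2) by (rule bij_betw_same_card)
  then have card: "int CARD('i) = int (card (edges n)) + int n - 3"
    using assms(1) by (simp add: card_coords)
  have inner: "(\<chi> i. \<phi> (c i)) \<bullet> char_vector c \<pi> = (\<Sum>C\<in>\<pi>. cluster_weight \<phi> C)"
    if "K_partition n K \<pi>" for K \<phi> \<pi>
    using inner_char_vector[OF assms(2)] that by (simp add: K_partition_def)
  have mid: "aff_dim (S K) = int CARD('i)" if "K \<in> {3..n - 2}" for K
  proof (rule aff_dim_full_if_no_hyperplane[OF assms(2)])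
    fix \<phi> b k assume *: "\<And>x. x \<in> S K \<Longrightarrow> (\<chi> i. \<phi> (c i)) \<bullet> x = b" and k: "k \<in> coords n"
    show "\<phi> k = 0"
    proof (rule functional_zero_middle[OF _ _ _ k])
      fix \<pi> assume "K_partition n K \<pi>"
      then show "(\<Sum>C\<in>\<pi>. cluster_weight \<phi> C) = b"
        using *[of "char_vector c \<pi>"] inner[of K \<pi> \<phi>] by (auto simp: S_def)
    qed (use that in auto)
  qed
  \<comment> \<open>With the origin in the set, the constant of a functional must be 0, which is the
    situation of \<open>functional_zero_two\<close>.\<close>
  have full: "aff_dim (insert 0 (S 2)) = int CARD('i)"
  proof (rule aff_dim_full_if_no_hyperplane[OF assms(2)])
    fix \<phi> b k assume *: "\<And>x. x \<in> insert 0 (S 2) \<Longrightarrow> (\<chi> i. \<phi> (c i)) \<bullet> x = b"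
      and k: "k \<in> coords n"
    have b: "b = 0" using *[of 0] by simp
    show "\<phi> k = 0"
    proof (rule functional_zero_two[OF assms(1) _ k])
      fix \<pi> assume "K_partition n 2 \<pi>"
      then show "(\<Sum>C\<in>\<pi>. cluster_weight \<phi> C) = 0"
        using *[of "char_vector c \<pi>"] inner[of 2 \<pi> \<phi>] b by (auto simp: S_def)
    qed
  qed
  let ?a = "\<chi> i. two_cluster_form (c i)"
  have "S 2 \<subseteq> {x. ?a \<bullet> x = 1}"
    using inner two_cluster_form_eq[OF _ assms(1)] by (auto simp: S_def)
  then have "affine hull (S 2) \<subseteq> {x. ?a \<bullet> x = 1}"
    by (rule hull_minimal) (rule affine_hyperplane)
  then have "0 \<notin> affine hull (S 2)" by auto
  \<comment> \<open>A point off the affine hull raises the dimension by exactly one, so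
    \<open>S 2\<close> lies one below \<open>full\<close>.\<close>
  then have two: "aff_dim (S 2) = int CARD('i) - 1"
    using full by (simp add: aff_dim_insert)
  have "S (n - 1) = (\<lambda>e. char_vector c (pair_partition n e)) ` edges n"
    using K_partition_pred_iff[of n] assms(1) by (auto simp: S_def)
  then have "aff_dim (S (n - 1)) = int (card (edges n)) - 1"
    using aff_dim_pair_partitions[OF assms(2)] by simp
  then show ?thesis using two mid card by (simp add: dim)
qed

end
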